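(* Fix an integer $b\ge1$ and put $\beta_b=\frac{b-1}{2b}$. Let $d\ge1$, let $U$ be a subset of the depth-$d$ binary interval $B_d$, and let $H$ be a graph on $U$ containing no ordered copy of the monotone path $\vec P_{b+1}$. For every $\eta>0$, the number of levels $\ell\in\{1,\dots,d\}$ satisfying $$e_\ell(H)\ge\beta_b\,UU_\ell+\eta\,\tau_{\ell,d}$$ is at most $$\frac{36(b+1)}{\eta^2}+\frac{b-1}{4b\,\eta}.$$
   Context: For $d\ge1$, the depth-$d$ binary interval is $B_d=\{0,1\}^d$ with lexicographic order. For $x<y$ in $B_d$ the level is $\delta(x,y)=\min\{i:x_i\ne y_i\}$. The number of pairs $x<y$ in $B_d$ with $\delta(x,y)=\ell$ is $\tau_{\ell,d}=2^{2d-\ell-1}$. For a graph $H$ on a subset of $B_d$, $e_\ell(H)$ is the number of edges $xy$ of $H$ ($x<y$) with $\delta(x,y)=\ell$. $UU_\ell$ is the number of pairs $x<y$ with $\delta(x,y)=\ell$ and $x,y\in U$. $\vec P_k$ is the monotone path on $k$ ordered vertices; an ordered copy of it in $H$ is a sequence $v_1<v_2<\cdots<v_k$ with $v_iv_{i+1}\in E(H)$ for $1\le i<k$. *)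

theory Defs
  imports Complex_Main "HOL-Library.List_Lexorder" "HOL-Library.Ramsey"
begin

text \<open>Points of the binary interval are Boolean lists (False for 0, True for 1), so that \<open><\<close> is
  the lexicographic order of \<^theory>\<open>HOL-Library.List_Lexorder\<close>.\<close>

definition binary_interval :: "nat \<Rightarrow> bool list set" where
  "binary_interval d = {x. length x = d}"

text \<open>Coordinates, hence levels, are numbered from 1. Only meaningful for distinct lists of equal
  length.\<close>

definition level :: "bool list \<Rightarrow> bool list \<Rightarrow> nat" where
  "level x y = Min {i \<in> {1..length x}. x ! (i - 1) \<noteq> y ! (i - 1)}"

definition level_pairs :: "bool list set \<Rightarrow> nat \<Rightarrow> (bool list \<times> bool list) set" where
  "level_pairs U l = {(x, y). x \<in> U \<and> y \<in> U \<and> x < y \<and> level x y = l}"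

definition num_level_pairs :: "bool list set \<Rightarrow> nat \<Rightarrow> nat" where
  "num_level_pairs U l = card (level_pairs U l)"

text \<open>The closed form for this number is lemma \<open>level_size_eq\<close> below.\<close>

definition level_size :: "nat \<Rightarrow> nat \<Rightarrow> nat" where
  "level_size l d = num_level_pairs (binary_interval d) l"

text \<open>A graph on \<open>U\<close> is given by its set \<open>H\<close> of edges, which are two-element subsets of \<open>U\<close>.\<close>

definition graph_on :: "bool list set \<Rightarrow> bool list set set \<Rightarrow> bool" where
  "graph_on U H \<longleftrightarrow> H \<subseteq> [U]\<^bsup>2\<^esup>"

definition num_level_edges :: "bool list set set \<Rightarrow> nat \<Rightarrow> nat" where
  "num_level_edges H l = card {(x, y). x < y \<and> {x, y} \<in> H \<and> level x y = l}"

definition has_monotone_path :: "bool list set \<Rightarrow> bool list set set \<Rightarrow> nat \<Rightarrow> bool" where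
  "has_monotone_path U H k \<longleftrightarrow>
     (\<exists>v. length v = k \<and> set v \<subseteq> U \<and> sorted_wrt (<) v \<and>
          (\<forall>i. Suc i < k \<longrightarrow> {v ! i, v ! Suc i} \<in> H))"

definition path_density :: "nat \<Rightarrow> real" where
  "path_density b = (real b - 1) / (2 * real b)"


lemma finite_binary_interval: "finite (binary_interval d)"
  using finite_lists_length_eq[of "UNIV :: bool set" d] by (simp add: binary_interval_def)

lemma card_binary_interval: "card (binary_interval d) = 2 ^ d"
  using card_lists_length_eq[of "UNIV :: bool set" d]
  by (simp add: binary_interval_def card_UNIV_bool)

lemma level_append:
  "level (p @ False # q) (p @ True # r) = Suc (length p)"
  unfolding level_def
proof (rule Min_eqI)
  fix i
  assume i: "i \<in> {i \<in> {1..length (p @ False # q)}.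
      (p @ False # q) ! (i - 1) \<noteq> (p @ True # r) ! (i - 1)}"
  show "Suc (length p) \<le> i"
  proof (rule ccontr)
    assume "\<not> Suc (length p) \<le> i"
    with i have "i - 1 < length p" by auto
    with i show False by (simp add: nth_append)
  qed
qed auto

lemma less_bool_list_iff:
  fixes x y :: "bool list"
  assumes "length x = length y"
  shows "x < y \<longleftrightarrow> (\<exists>p q r. x = p @ False # q \<and> y = p @ True # r \<and> length q = length r)"
proof
  assume "x < y"
  then have "(\<exists>a v. y = x @ a # v) \<or>
      (\<exists>p a b q r. a < b \<and> x = p @ a # q \<and> y = p @ b # r)"
    by (auto simp: list_less_def lexord_def simp del: less_bool_def)
  with assms obtain p a b q r where *: "a < b" "x = p @ a # q" "y = p @ b # r"
    by auto
  then have "\<not> a" "b" by auto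
  with * assms show "\<exists>p q r. x = p @ False # q \<and> y = p @ True # r \<and> length q = length r"
    by (intro exI[of _ p] exI[of _ q] exI[of _ r]) simp
next
  assume "\<exists>p q r. x = p @ False # q \<and> y = p @ True # r \<and> length q = length r"
  then obtain p q r where "x = p @ False # q" "y = p @ True # r" by blast
  then show "x < y"
    unfolding list_less_def by (simp add: lexord_append_left_rightI)
qed

lemma level_size_eq:
  assumes "1 \<le> l" "l \<le> d"
  shows "level_size l d = 2 ^ (2 * d - l - 1)"
proof -
  let ?f = "\<lambda>(p, q, r). (p @ False # q, p @ True # r)"
  let ?A = "binary_interval (l - 1) \<times> binary_interval (d - l) \<times> binary_interval (d - l)"
  have "level_pairs (binary_interval d) l = ?f ` ?A"
  proof (intro equalityI subsetI)
    fix z assume "z \<in> level_pairs (binary_interval d) l"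
    then obtain x y where z: "z = (x, y)" "length x = d" "length y = d" "x < y" "level x y = l"
      by (auto simp: level_pairs_def binary_interval_def)
    then obtain p q r where "x = p @ False # q" "y = p @ True # r" "length q = length r"
      using less_bool_list_iff[of x y] by auto
    with z show "z \<in> ?f ` ?A"
      by (auto simp: level_append binary_interval_def intro!: image_eqI[where x = "(p, q, r)"])
  next
    fix z assume "z \<in> ?f ` ?A"
    then obtain p q r where z: "z = (p @ False # q, p @ True # r)"
      "length p = l - 1" "length q = d - l" "length r = d - l"
      by (auto simp: binary_interval_def)
    then have "p @ False # q < p @ True # r"
      using less_bool_list_iff[of "p @ False # q" "p @ True # r"] by (metis length_append length_Cons)
    with z assms show "z \<in> level_pairs (binary_interval d) l"
      by (auto simp: level_pairs_def binary_interval_def level_append)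
  qed
  moreover have "inj_on ?f ?A"
    by (auto simp: inj_on_def binary_interval_def)
  ultimately have "level_size l d = card ?A"
    by (simp add: level_size_def num_level_pairs_def card_image)
  also have "\<dots> = 2 ^ ((l - 1) + ((d - l) + (d - l)))"
    by (simp add: card_cartesian_product card_binary_interval power_add)
  also have "(l - 1) + ((d - l) + (d - l)) = 2 * d - l - 1"
    using assms by simp
  finally show ?thesis .
qed

end

theory Submission
  imports Defs "HOL-Analysis.Convex"
begin

text \<open>
  The idea is that of an energy increment. Give each point of \<open>U\<close> as colour the length of the
  longest monotone path ending there. Only \<open>b\<close> colours occur, and they strictly increase along edges,
  so \<open>U\<close> splits into classes \<open>V\<^sub>0, \<dots>, V\<^sub>b\<^sub>-\<^sub>1\<close> such that the lower endpoint of every edge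
  lies in a class of smaller index (\<open>colouring_of_no_monotone_path\<close>).

  View \<open>binary_interval d\<close> as the leaves of a binary tree. The pairs of level \<open>n + 1\<close> are the pairs of
  leaves that branch at a node of depth \<open>n\<close>. Let \<open>x\<^sub>i\<close> and \<open>y\<^sub>i\<close> be the densities of \<open>V\<^sub>i\<close> below the
  left and the right child of such a node, and \<open>X\<close>, \<open>Y\<close> the sums of the \<open>x\<^sub>i\<close> and the \<open>y\<^sub>i\<close>. The node
  contributes at most the sum of the \<open>x\<^sub>i y\<^sub>j\<close> with \<open>i < j\<close>. If \<open>x = y\<close>, this is at most
  \<open>path_density b * X * Y\<close> by Cauchy-Schwarz, and in general the error is controlled by the half
  jumps \<open>\<delta>\<^sub>i = (y\<^sub>i - x\<^sub>i) / 2\<close> (\<open>cross_sum_le\<close>): it is at most the sum of the \<open>\<bar>\<delta>\<^sub>i\<bar>\<close> plus half the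
  sum of the \<open>\<delta>\<^sub>i\<^sup>2\<close>.

  Let \<open>D\<^sub>n\<close> be the average of the sum of the \<open>\<delta>\<^sub>i\<^sup>2\<close> over the nodes of depth \<open>n\<close>. The densities of a class
  along a random branch form a martingale, so \<open>D\<^sub>n\<close> is the increment of the mean square density from
  depth \<open>n\<close> to depth \<open>n + 1\<close>, and the sum of all \<open>D\<^sub>n\<close> is at most 1 (\<open>sum_half_jump_squares_le\<close>). A level
  with excess \<open>\<eta>\<close> satisfies \<open>\<eta> \<le> sqrt (b D\<^sub>n) + D\<^sub>n / 2\<close> by the two previous paragraphs, hence
  \<open>\<eta>\<^sup>2 \<le> (2 b + 1) D\<^sub>n\<close> (\<open>dense_level_energy\<close>). There are thus at most \<open>(2 b + 1) / \<eta>\<^sup>2\<close> such levels,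
  which is stronger than the stated bound.
\<close>

section \<open>Colouring by longest paths\<close>

text \<open>The colour of \<open>x\<close> is the greatest number of points that can precede \<open>x\<close> on a monotone path.
  An edge from \<open>x\<close> up to \<open>y\<close> prolongs every path ending in \<open>x\<close>, so the colour grows.\<close>

lemma colouring_of_no_monotone_path:
  assumes "graph_on U H" and nopath: "\<not> has_monotone_path U H (b + 1)"
  obtains c :: "bool list \<Rightarrow> nat" where "\<And>x. x \<in> U \<Longrightarrow> c x < b"
    and "\<And>x y. x < y \<Longrightarrow> {x, y} \<in> H \<Longrightarrow> c x < c y"
proof -
  define path where "path v \<longleftrightarrow> set v \<subseteq> U \<and> sorted_wrt (<) v \<and>
      (\<forall>i. Suc i < length v \<longrightarrow> {v ! i, v ! Suc i} \<in> H)" for v :: "bool list list"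
  define K where "K x = {k. \<exists>v. path (v @ [x]) \<and> length v = k}" for x
  have short: "length v \<le> b" if "path v" for v
  proof (rule ccontr)
    assume "\<not> length v \<le> b"
    then have "has_monotone_path U H (b + 1)"
      using that set_take_subset[of "b + 1" v] unfolding has_monotone_path_def path_def
      by (intro exI[of _ "take (b + 1) v"]) (auto simp: sorted_wrt_take)
    with nopath show False by simp
  qed
  have bound: "k < b" if "k \<in> K x" for k x
    using that short by (fastforce simp: K_def)
  then have fin: "finite (K x)" for x
    by (meson finite_nat_iff_bounded lessThan_iff subsetI)
  have zero: "0 \<in> K x" if "x \<in> U" for x
    using that by (auto simp: K_def path_def)
  show ?thesis
  proof
    fix x assume "x \<in> U"
    then show "Max (K x) < b"
      using bound fin zero by (metis Max_in empty_iff)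
  next
    fix x y assume xy: "x < y" "{x, y} \<in> H"
    then have U: "x \<in> U" "y \<in> U"
      using assms(1) by (auto simp: graph_on_def nsets_def)
    have "Max (K x) \<in> K x" using fin zero U Max_in by (metis empty_iff)
    then obtain v where v: "path (v @ [x])" "length v = Max (K x)"
      by (auto simp: K_def)
    have "path ((v @ [x]) @ [y])"
      unfolding path_def
    proof (intro conjI allI impI)
      show "set ((v @ [x]) @ [y]) \<subseteq> U" using v U by (auto simp: path_def)
      show "sorted_wrt (<) ((v @ [x]) @ [y])"
        using v xy by (auto simp: path_def sorted_wrt_append)
      fix i assume i: "Suc i < length ((v @ [x]) @ [y])"
      show "{((v @ [x]) @ [y]) ! i, ((v @ [x]) @ [y]) ! Suc i} \<in> H"
      proof (cases "Suc i < length (v @ [x])")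
        case True
        then show ?thesis using v unfolding path_def
          by (metis Suc_lessD nth_append)
      next
        case False
        with i have "i = length v" by simp
        then show ?thesis using xy by (simp add: nth_append)
      qed
    qed
    then have "Suc (Max (K x)) \<in> K y"
      using v(2) by (auto simp: K_def intro!: exI[of _ "v @ [x]"])
    then show "Max (K x) < Max (K y)"
      using fin Max_ge Suc_le_lessD by blast
  qed
qed

section \<open>Densities in cylinders\<close>

definition cylinder :: "bool list set \<Rightarrow> bool list \<Rightarrow> bool list set" where
  "cylinder V p = {x \<in> V. take (length p) x = p}"

text \<open>The denominator is the number of leaves below \<open>p\<close>, so this is the proportion of these leaves that
  belong to \<open>V\<close>.\<close>

definition density :: "nat \<Rightarrow> bool list set \<Rightarrow> bool list \<Rightarrow> real" where
  "density d V p = real (card (cylinder V p)) / 2 ^ (d - length p)"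

text \<open>By \<open>density_split\<close>, the densities at the two children of \<open>p\<close> are the density at \<open>p\<close>
  minus and plus the half jump.\<close>

definition half_jump :: "nat \<Rightarrow> bool list set \<Rightarrow> bool list \<Rightarrow> real" where
  "half_jump d V p = (density d V (p @ [True]) - density d V (p @ [False])) / 2"

text \<open>This is the second moment of the density at a uniformly random node of depth \<open>n\<close>.\<close>

definition energy :: "nat \<Rightarrow> bool list set \<Rightarrow> nat \<Rightarrow> real" where
  "energy d V n = (\<Sum>p\<in>binary_interval n. (density d V p)\<^sup>2) / 2 ^ n"

lemma finite_cylinder: "V \<subseteq> binary_interval d \<Longrightarrow> finite (cylinder V p)"
  using finite_subset[OF _ finite_binary_interval[of d]] by (auto simp: cylinder_def)

lemma density_nonneg: "0 \<le> density d V p"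
  by (simp add: density_def)

lemma density_le_1:
  assumes "V \<subseteq> binary_interval d" "length p \<le> d"
  shows "density d V p \<le> 1"
proof -
  have "cylinder V p \<subseteq> (\<lambda>s. p @ s) ` binary_interval (d - length p)"
  proof
    fix x assume x: "x \<in> cylinder V p"
    then have "x = p @ drop (length p) x"
      by (metis (mono_tags, lifting) append_take_drop_id cylinder_def mem_Collect_eq)
    moreover have "drop (length p) x \<in> binary_interval (d - length p)"
      using x assms by (auto simp: cylinder_def binary_interval_def)
    ultimately show "x \<in> (\<lambda>s. p @ s) ` binary_interval (d - length p)" by blast
  qed
  then have "card (cylinder V p) \<le> card (binary_interval (d - length p))"
    by (meson finite_binary_interval surj_card_le)
  then have "real (card (cylinder V p)) \<le> real (2 ^ (d - length p))"
    unfolding card_binary_interval of_nat_le_iff .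
  then show ?thesis by (simp add: density_def)
qed

lemma density_split:
  assumes "V \<subseteq> binary_interval d" "length p < d"
  shows "density d V p = (density d V (p @ [False]) + density d V (p @ [True])) / 2"
proof -
  have "take (Suc (length p)) x = take (length p) x @ [x ! length p]" if "x \<in> V" for x
    using that assms by (intro take_Suc_conv_app_nth) (auto simp: binary_interval_def)
  then have "cylinder V p = cylinder V (p @ [False]) \<union> cylinder V (p @ [True])"
    by (auto simp: cylinder_def)
  moreover have "cylinder V (p @ [False]) \<inter> cylinder V (p @ [True]) = {}"
    by (auto simp: cylinder_def)
  ultimately have "card (cylinder V p) = card (cylinder V (p @ [False])) + card (cylinder V (p @ [True]))"
    using finite_cylinder[OF assms(1)] by (simp add: card_Un_disjoint)
  moreover have "(2::real) ^ (d - length p) = 2 * 2 ^ (d - Suc (length p))"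
    using assms(2) by (metis Suc_diff_Suc power_Suc)
  ultimately show ?thesis
    by (simp add: density_def add_divide_distrib)
qed

lemma density_leaf:
  assumes "V \<subseteq> binary_interval d" "length p = d"
  shows "density d V p = (if p \<in> V then 1 else 0)"
proof -
  have "cylinder V p = (if p \<in> V then {p} else {})"
    using assms by (auto simp: cylinder_def binary_interval_def)
  then show ?thesis using assms by (simp add: density_def)
qed

lemma density_partition:
  fixes c :: "bool list \<Rightarrow> nat"
  assumes "U \<subseteq> binary_interval d" "\<And>x. x \<in> U \<Longrightarrow> c x < b"
  shows "(\<Sum>i<b. density d {x \<in> U. c x = i} p) = density d U p"
proof -
  have "cylinder U p = (\<Union>i\<in>{..<b}. cylinder {x \<in> U. c x = i} p)"
    using assms(2) by (auto simp: cylinder_def)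
  also have "card \<dots> = (\<Sum>i<b. card (cylinder {x \<in> U. c x = i} p))"
    using assms(1) by (intro card_UN_disjoint ballI finite_cylinder[of _ d]) (auto simp: cylinder_def)
  finally show ?thesis by (simp add: density_def sum_divide_distrib)
qed

lemma sum_binary_interval_Suc:
  fixes f :: "bool list \<Rightarrow> real"
  shows "(\<Sum>p\<in>binary_interval (Suc n). f p) = (\<Sum>p\<in>binary_interval n. f (p @ [False]) + f (p @ [True]))"
proof -
  have "binary_interval (Suc n) = (\<lambda>p. p @ [False]) ` binary_interval n \<union> (\<lambda>p. p @ [True]) ` binary_interval n"
    (is "_ = ?L \<union> ?R")
  proof (intro equalityI subsetI)
    fix x assume "x \<in> binary_interval (Suc n)"
    then obtain p a where "x = p @ [a]" "length p = n"
      by (auto simp: binary_interval_def length_Suc_conv_rev)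
    then show "x \<in> ?L \<union> ?R" by (cases a) (auto simp: binary_interval_def)
  qed (auto simp: binary_interval_def)
  moreover have "?L \<inter> ?R = {}" by auto
  ultimately have "sum f (binary_interval (Suc n)) = sum f ?L + sum f ?R"
    by (simp add: sum.union_disjoint finite_binary_interval)
  also have "\<dots> = (\<Sum>p\<in>binary_interval n. f (p @ [False]) + f (p @ [True]))"
    by (simp add: sum.reindex inj_on_def sum.distrib)
  finally show ?thesis .
qed

text \<open>Orthogonality of martingale differences, node by node: \<open>((a - t)\<^sup>2 + (a + t)\<^sup>2) / 2 = a\<^sup>2 + t\<^sup>2\<close>.\<close>

lemma energy_increment:
  assumes "V \<subseteq> binary_interval d" "n < d"
  shows "energy d V (Suc n) - energy d V n = (\<Sum>p\<in>binary_interval n. (half_jump d V p)\<^sup>2) / 2 ^ n"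
proof -
  have "((density d V (p @ [False]))\<^sup>2 + (density d V (p @ [True]))\<^sup>2) / 2 =
      (density d V p)\<^sup>2 + (half_jump d V p)\<^sup>2" if "p \<in> binary_interval n" for p
  proof -
    have "density d V p = (density d V (p @ [False]) + density d V (p @ [True])) / 2"
      using that assms by (intro density_split) (auto simp: binary_interval_def)
    then show ?thesis
      by (simp only: half_jump_def) (simp add: power2_eq_square field_simps)
  qed
  then have "(\<Sum>p\<in>binary_interval (Suc n). (density d V p)\<^sup>2) / 2 =
      (\<Sum>p\<in>binary_interval n. (density d V p)\<^sup>2 + (half_jump d V p)\<^sup>2)"
    unfolding sum_binary_interval_Suc sum_divide_distrib by (intro sum.cong) auto
  then have "energy d V (Suc n) =
      (\<Sum>p\<in>binary_interval n. (density d V p)\<^sup>2 + (half_jump d V p)\<^sup>2) / 2 ^ n"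
    by (simp add: energy_def field_simps)
  then show ?thesis
    by (simp add: energy_def sum.distrib add_divide_distrib)
qed

text \<open>The increments telescope to at most the energy at the leaves; there the density is the indicator
  of \<open>V\<close>, which equals its own square. Keeping the bound proportional to \<open>card V\<close>, instead of 1,
  makes the total over disjoint sets at most 1, with no loss of a factor \<open>b\<close>.\<close>

lemma sum_half_jump_squares_le:
  assumes "V \<subseteq> binary_interval d"
  shows "(\<Sum>n<d. (\<Sum>p\<in>binary_interval n. (half_jump d V p)\<^sup>2) / 2 ^ n) \<le> card V / 2 ^ d"
proof -
  have "(\<Sum>n<d. (\<Sum>p\<in>binary_interval n. (half_jump d V p)\<^sup>2) / 2 ^ n) =
      (\<Sum>n<d. energy d V (Suc n) - energy d V n)"
    using energy_increment[OF assms] by (intro sum.cong) auto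
  also have "\<dots> = energy d V d - energy d V 0"
    by (rule sum_lessThan_telescope)
  also have "\<dots> \<le> energy d V d"
    by (simp add: energy_def sum_nonneg)
  also have "\<dots> = (\<Sum>p\<in>binary_interval d. if p \<in> V then 1 else 0) / 2 ^ d"
    unfolding energy_def using density_leaf[OF assms]
    by (intro arg_cong2[where f = "(/)"] sum.cong) (auto simp: binary_interval_def)
  also have "\<dots> = card V / 2 ^ d"
    using assms finite_binary_interval[of d] by (simp add: sum.If_cases Int_absorb1)
  finally show ?thesis .
qed

section \<open>Pairs on a level\<close>

definition cross_pairs :: "bool list set \<Rightarrow> bool list set \<Rightarrow> nat \<Rightarrow> (bool list \<times> bool list) set" where
  "cross_pairs V W l = {(x, y). x \<in> V \<and> y \<in> W \<and> x < y \<and> level x y = l}"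

text \<open>If \<open>p\<close> is the longest common prefix of \<open>x < y\<close>, then \<open>x\<close> continues with \<open>False\<close> and \<open>y\<close> with \<open>True\<close>, so
  the pairs of a level are sorted by the node at which they branch. Levels count from 1 but depths
  from 0, whence the \<open>Suc\<close>.\<close>

lemma cross_pairs_eq_Union:
  assumes "V \<subseteq> binary_interval d" "W \<subseteq> binary_interval d" "n < d"
  shows "cross_pairs V W (Suc n) =
    (\<Union>p\<in>binary_interval n. cylinder V (p @ [False]) \<times> cylinder W (p @ [True]))"
proof (intro equalityI subsetI)
  fix z assume "z \<in> cross_pairs V W (Suc n)"
  then obtain x y where z: "z = (x, y)" "x \<in> V" "y \<in> W" "x < y" "level x y = Suc n"
    by (auto simp: cross_pairs_def)
  with assms have "length x = length y" by (auto simp: binary_interval_def)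
  with z obtain p q r where pqr: "x = p @ False # q" "y = p @ True # r"
    using less_bool_list_iff by blast
  with z have "length p = n" by (simp add: level_append)
  then have "p \<in> binary_interval n" by (simp add: binary_interval_def)
  moreover have "x \<in> cylinder V (p @ [False])" "y \<in> cylinder W (p @ [True])"
    using z(2,3) pqr by (simp_all add: cylinder_def)
  ultimately show "z \<in> (\<Union>p\<in>binary_interval n. cylinder V (p @ [False]) \<times> cylinder W (p @ [True]))"
    unfolding z(1) by blast
next
  fix z assume "z \<in> (\<Union>p\<in>binary_interval n. cylinder V (p @ [False]) \<times> cylinder W (p @ [True]))"
  then obtain p x y where z: "z = (x, y)" "length p = n" "x \<in> V" "y \<in> W"
    "take (Suc n) x = p @ [False]" "take (Suc n) y = p @ [True]"
    by (auto simp: cylinder_def binary_interval_def)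
  then have "x = p @ False # drop (Suc n) x" "y = p @ True # drop (Suc n) y"
    by (metis append.assoc append_Cons append_Nil append_take_drop_id)+
  moreover have "length x = length y" using z assms by (auto simp: binary_interval_def)
  ultimately have "x < y" "level x y = Suc n"
    using less_bool_list_iff[of x y] level_append[of p "drop (Suc n) x" "drop (Suc n) y"] z(2)
    by (metis length_drop)+
  with z show "z \<in> cross_pairs V W (Suc n)" by (auto simp: cross_pairs_def)
qed

lemma card_cross_pairs:
  assumes "V \<subseteq> binary_interval d" "W \<subseteq> binary_interval d" "n < d"
  shows "real (card (cross_pairs V W (Suc n))) = real (level_size (Suc n) d) *
    ((\<Sum>p\<in>binary_interval n. density d V (p @ [False]) * density d W (p @ [True])) / 2 ^ n)"
proof -
  have "card (cross_pairs V W (Suc n)) =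
      (\<Sum>p\<in>binary_interval n. card (cylinder V (p @ [False]) \<times> cylinder W (p @ [True])))"
    unfolding cross_pairs_eq_Union[OF assms]
    by (intro card_UN_disjoint finite_binary_interval ballI finite_cartesian_product
        finite_cylinder[OF assms(1)] finite_cylinder[OF assms(2)])
      (auto simp: cylinder_def binary_interval_def)
  also have "real \<dots> = (\<Sum>p\<in>binary_interval n.
      2 ^ (d - Suc n) * 2 ^ (d - Suc n) * (density d V (p @ [False]) * density d W (p @ [True])))"
    unfolding of_nat_sum
    by (intro sum.cong) (auto simp: card_cartesian_product density_def binary_interval_def)
  also have "\<dots> = 2 ^ (d - Suc n) * 2 ^ (d - Suc n) *
      (\<Sum>p\<in>binary_interval n. density d V (p @ [False]) * density d W (p @ [True]))"
    by (simp add: sum_distrib_left)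
  also have "2 ^ (d - Suc n) * 2 ^ (d - Suc n) = (2 ^ (2 * d - Suc n - 1) / 2 ^ n :: real)"
  proof -
    have "d - Suc n + (d - Suc n) + n = 2 * d - Suc n - 1" using assms(3) by simp
    then have "(2::real) ^ (d - Suc n) * 2 ^ (d - Suc n) * 2 ^ n = 2 ^ (2 * d - Suc n - 1)"
      by (metis power_add)
    then show ?thesis by (simp add: eq_divide_eq)
  qed
  finally show ?thesis using assms(3) by (simp add: level_size_eq)
qed

section \<open>The inequality at one vertex of the tree\<close>

text \<open>The square of index pairs splits into the two open triangles and the diagonal.\<close>

lemma sum_pairs_symmetrise:
  fixes f :: "nat \<Rightarrow> nat \<Rightarrow> real"
  shows "(\<Sum>j<b. \<Sum>i<j. f i j + f j i) + (\<Sum>i<b. f i i) = (\<Sum>j<b. \<Sum>i<b. f i j)"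
  by (induction b) (simp_all add: sum.distrib)

text \<open>The sum over \<open>i < j\<close> of \<open>x\<^sub>i y\<^sub>j\<close> is split into its symmetric and its antisymmetric half. The
  symmetric half is \<open>(X Y - \<Sum>x\<^sub>i y\<^sub>i) / 2\<close>, where \<open>x\<^sub>i y\<^sub>i\<close> is the square of the mean of \<open>x\<^sub>i\<close> and \<open>y\<^sub>i\<close> minus
  \<open>\<delta>\<^sub>i\<^sup>2\<close>; Cauchy-Schwarz for the means, followed by \<open>X Y \<le> ((X + Y) / 2)\<^sup>2\<close>, yields the main term.
  The antisymmetric half vanishes when \<open>x = y\<close>, hence is linear in \<open>\<delta>\<close>.\<close>

lemma cross_sum_le:
  fixes x y :: "nat \<Rightarrow> real"
  assumes b: "b \<ge> 1" and x: "\<And>i. x i \<ge> 0" and X: "(\<Sum>i<b. x i) \<le> 1"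
  shows "(\<Sum>j<b. \<Sum>i<j. x i * y j) \<le> path_density b * ((\<Sum>i<b. x i) * (\<Sum>i<b. y i))
     + (\<Sum>i<b. \<bar>(y i - x i) / 2\<bar>) + (\<Sum>i<b. ((y i - x i) / 2)\<^sup>2) / 2"
proof -
  define \<delta> where "\<delta> i = (y i - x i) / 2" for i
  define X where "X = (\<Sum>i<b. x i)"
  define Y where "Y = (\<Sum>i<b. y i)"
  have y: "y i = x i + 2 * \<delta> i" for i by (simp add: \<delta>_def field_simps)
  have prod: "(\<Sum>j<b. \<Sum>i<b. x i * g j) = X * (\<Sum>j<b. g j)" for g :: "nat \<Rightarrow> real"
    by (simp add: X_def flip: sum_distrib_left sum_distrib_right)
  have sym: "(\<Sum>j<b. \<Sum>i<j. x i * y j + x j * y i) \<le> X * Y * (1 - 1 / b) + (\<Sum>i<b. (\<delta> i)\<^sup>2)"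
  proof -
    have "X * Y \<le> ((X + Y) / 2)\<^sup>2"
      using sum_squares_ge_zero[of "X - Y" 0] by (simp add: power2_eq_square field_simps)
    also have "(X + Y) / 2 = (\<Sum>i<b. (x i + y i) / 2)"
      by (simp add: X_def Y_def sum.distrib flip: sum_divide_distrib)
    also have "\<dots>\<^sup>2 \<le> (\<Sum>i<b. ((x i + y i) / 2)\<^sup>2) * b"
      using sum_squared_le_sum_of_squares[of "\<lambda>i. (x i + y i) / 2" "{..<b}"] by simp
    also have "(\<Sum>i<b. ((x i + y i) / 2)\<^sup>2) = (\<Sum>i<b. x i * y i) + (\<Sum>i<b. (\<delta> i)\<^sup>2)"
      unfolding sum.distrib[symmetric]
      by (intro sum.cong) (auto simp: \<delta>_def power2_eq_square field_simps)
    finally have "X * Y / b \<le> (\<Sum>i<b. x i * y i) + (\<Sum>i<b. (\<delta> i)\<^sup>2)"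
      using b by (simp add: divide_le_eq)
    moreover have "(\<Sum>j<b. \<Sum>i<j. x i * y j + x j * y i) + (\<Sum>i<b. x i * y i) = X * Y"
      using sum_pairs_symmetrise[of "\<lambda>i j. x i * y j" b] by (simp add: prod Y_def)
    ultimately show ?thesis by (simp add: algebra_simps)
  qed
  have anti: "(\<Sum>j<b. \<Sum>i<j. x i * \<delta> j - x j * \<delta> i) \<le> (\<Sum>i<b. \<bar>\<delta> i\<bar>)"
  proof -
    have "x i * \<delta> j - x j * \<delta> i \<le> x i * \<bar>\<delta> j\<bar> + x j * \<bar>\<delta> i\<bar>" for i j
      using mult_left_mono[OF abs_ge_self x, of i "\<delta> j"]
        mult_left_mono[OF abs_ge_minus_self x, of j "\<delta> i"] by simp
    then have "(\<Sum>j<b. \<Sum>i<j. x i * \<delta> j - x j * \<delta> i) \<le> (\<Sum>j<b. \<Sum>i<j. x i * \<bar>\<delta> j\<bar> + x j * \<bar>\<delta> i\<bar>)"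
      by (intro sum_mono)
    also have "\<dots> \<le> X * (\<Sum>i<b. \<bar>\<delta> i\<bar>)"
    proof -
      have "0 \<le> (\<Sum>i<b. x i * \<bar>\<delta> i\<bar>)" using x by (simp add: sum_nonneg)
      then show ?thesis
        using sum_pairs_symmetrise[of "\<lambda>i j. x i * \<bar>\<delta> j\<bar>" b] unfolding prod by linarith
    qed
    also have "\<dots> \<le> (\<Sum>i<b. \<bar>\<delta> i\<bar>)"
      using X by (intro mult_left_le_one_le) (auto simp: X_def sum_nonneg x)
    finally show ?thesis .
  qed
  have "(\<Sum>j<b. \<Sum>i<j. x i * y j) =
      (\<Sum>j<b. \<Sum>i<j. x i * y j + x j * y i) / 2 + (\<Sum>j<b. \<Sum>i<j. x i * \<delta> j - x j * \<delta> i)"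
    unfolding sum_divide_distrib sum.distrib[symmetric]
    by (intro sum.cong) (auto simp: y field_simps)
  also have "\<dots> \<le> (X * Y * (1 - 1 / b) + (\<Sum>i<b. (\<delta> i)\<^sup>2)) / 2 + (\<Sum>i<b. \<bar>\<delta> i\<bar>)"
    by (intro add_mono divide_right_mono sym anti) simp
  also have "\<dots> = path_density b * (X * Y) + (\<Sum>i<b. \<bar>\<delta> i\<bar>) + (\<Sum>i<b. (\<delta> i)\<^sup>2) / 2"
    using b by (simp add: path_density_def field_simps)
  finally show ?thesis by (simp add: \<delta>_def X_def Y_def)
qed

section \<open>Counting the dense levels\<close>

lemma num_level_edges_le:
  fixes c :: "bool list \<Rightarrow> nat"
  assumes U: "U \<subseteq> binary_interval d" and "graph_on U H" and cb: "\<And>x. x \<in> U \<Longrightarrow> c x < b"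
    and "\<And>x y. x < y \<Longrightarrow> {x, y} \<in> H \<Longrightarrow> c x < c y"
  shows "num_level_edges H l \<le>
    (\<Sum>j<b. \<Sum>i<j. card (cross_pairs {x \<in> U. c x = i} {x \<in> U. c x = j} l))"
proof -
  let ?P = "\<lambda>i j. cross_pairs {x \<in> U. c x = i} {x \<in> U. c x = j} l"
  have "finite (U \<times> U)" using U finite_binary_interval finite_subset by blast
  then have "finite (?P i j)" for i j
    by (rule finite_subset[rotated]) (auto simp: cross_pairs_def)
  moreover have "{(x, y). x < y \<and> {x, y} \<in> H \<and> level x y = l} \<subseteq> (\<Union>j<b. \<Union>i<j. ?P i j)"
  proof clarify
    fix x y assume xy: "x < y" "{x, y} \<in> H" "l = level x y"
    then have "x \<in> U" "y \<in> U" using assms(2) by (auto simp: graph_on_def nsets_def)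
    then have "c y \<in> {..<b}" "c x \<in> {..<c y}" "(x, y) \<in> cross_pairs {z \<in> U. c z = c x} {z \<in> U. c z = c y} (level x y)"
      using xy assms(3,4) by (auto simp: cross_pairs_def)
    then show "(x, y) \<in> (\<Union>j<b. \<Union>i<j. cross_pairs {x \<in> U. c x = i} {x \<in> U. c x = j} (level x y))"
      by blast
  qed
  ultimately have "num_level_edges H l \<le> card (\<Union>j<b. \<Union>i<j. ?P i j)"
    unfolding num_level_edges_def by (intro card_mono) auto
  also have "\<dots> \<le> (\<Sum>j<b. card (\<Union>i<j. ?P i j))"
    by (intro card_UN_le) auto
  also have "\<dots> \<le> (\<Sum>j<b. \<Sum>i<j. card (?P i j))"
    by (intro sum_mono card_UN_le) auto
  finally show ?thesis .
qed

text \<open>The node inequality is averaged over the nodes of depth \<open>n\<close>. Its error becomes \<open>E + D / 2\<close>, with \<open>E\<close> the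
  average of the linear term; Cauchy-Schwarz over all pairs of a node and a class gives
  \<open>E\<^sup>2 \<le> b D\<close>.\<close>

lemma dense_level_energy:
  fixes c :: "bool list \<Rightarrow> nat" and \<eta> :: real
  assumes "b \<ge> 1" and U: "U \<subseteq> binary_interval d" and "graph_on U H"
    and cb: "\<And>x. x \<in> U \<Longrightarrow> c x < b"
    and "\<And>x y. x < y \<Longrightarrow> {x, y} \<in> H \<Longrightarrow> c x < c y"
    and n: "n < d" and "\<eta> > 0"
    and dense: "real (num_level_edges H (Suc n)) \<ge>
      path_density b * real (num_level_pairs U (Suc n)) + \<eta> * real (level_size (Suc n) d)"
  defines "D \<equiv> (\<Sum>i<b. (\<Sum>p\<in>binary_interval n. (half_jump d {x \<in> U. c x = i} p)\<^sup>2) / 2 ^ n)"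
  assumes "D \<le> 1"
  shows "\<eta>\<^sup>2 \<le> (2 * real b + 1) * D"
proof -
  let ?V = "\<lambda>i. {x \<in> U. c x = i}" and ?B = "binary_interval n"
  let ?L = "\<lambda>i p. density d (?V i) (p @ [False])" and ?R = "\<lambda>i p. density d (?V i) (p @ [True])"
  let ?\<delta> = "\<lambda>i p. half_jump d (?V i) p"
  define E where "E = (\<Sum>p\<in>?B. \<Sum>i<b. \<bar>?\<delta> i p\<bar>) / 2 ^ n"
  define Q where "Q = (\<Sum>p\<in>?B. \<Sum>j<b. \<Sum>i<j. ?L i p * ?R j p) / 2 ^ n"
  define T where "T = real (level_size (Suc n) d)"
  define u where "u = (\<Sum>p\<in>?B. density d U (p @ [False]) * density d U (p @ [True])) / 2 ^ n"
  have V: "?V i \<subseteq> binary_interval d" for i using U by auto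
  have T: "T > 0" using n by (simp add: T_def level_size_eq)
  have D: "D = (\<Sum>p\<in>?B. \<Sum>i<b. (?\<delta> i p)\<^sup>2) / 2 ^ n"
    unfolding D_def sum_divide_distrib by (rule sum.swap)
  have "real (num_level_edges H (Suc n)) \<le>
      real (\<Sum>j<b. \<Sum>i<j. card (cross_pairs (?V i) (?V j) (Suc n)))"
    unfolding of_nat_le_iff by (rule num_level_edges_le[OF assms(2-5)])
  also have "\<dots> = (\<Sum>j<b. \<Sum>i<j. T * ((\<Sum>p\<in>?B. ?L i p * ?R j p) / 2 ^ n))"
    by (simp add: card_cross_pairs[OF V V n] T_def)
  also have "\<dots> = T * ((\<Sum>j<b. \<Sum>i<j. \<Sum>p\<in>?B. ?L i p * ?R j p) / 2 ^ n)"
    by (simp only: sum_distrib_left sum_divide_distrib)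
  also have "(\<Sum>j<b. \<Sum>i<j. \<Sum>p\<in>?B. ?L i p * ?R j p) = (\<Sum>p\<in>?B. \<Sum>j<b. \<Sum>i<j. ?L i p * ?R j p)"
    by (simp only: sum.swap[of _ ?B])
  finally have e: "real (num_level_edges H (Suc n)) \<le> T * Q"
    by (simp only: Q_def)
  have "(\<Sum>j<b. \<Sum>i<j. ?L i p * ?R j p) \<le>
      path_density b * (density d U (p @ [False]) * density d U (p @ [True]))
      + (\<Sum>i<b. \<bar>?\<delta> i p\<bar>) + (\<Sum>i<b. (?\<delta> i p)\<^sup>2) / 2" if "p \<in> ?B" for p
  proof -
    have "density d U (p @ [False]) \<le> 1"
      using that n U by (intro density_le_1) (auto simp: binary_interval_def)
    then show ?thesis
      using cross_sum_le[of b "\<lambda>i. ?L i p" "\<lambda>i. ?R i p"] assms(1)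
      by (simp add: density_nonneg density_partition[OF U cb] half_jump_def)
  qed
  then have "(\<Sum>p\<in>?B. \<Sum>j<b. \<Sum>i<j. ?L i p * ?R j p) \<le>
    (\<Sum>p\<in>?B. path_density b * (density d U (p @ [False]) * density d U (p @ [True]))
      + (\<Sum>i<b. \<bar>?\<delta> i p\<bar>) + (\<Sum>i<b. (?\<delta> i p)\<^sup>2) / 2)"
    by (rule sum_mono)
  then have "Q \<le>
    (\<Sum>p\<in>?B. path_density b * (density d U (p @ [False]) * density d U (p @ [True]))
      + (\<Sum>i<b. \<bar>?\<delta> i p\<bar>) + (\<Sum>i<b. (?\<delta> i p)\<^sup>2) / 2) / 2 ^ n"
    unfolding Q_def by (rule divide_right_mono) simp
  also have "\<dots> = path_density b * u + E + D / 2"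
    by (simp add: u_def E_def D sum.distrib add_divide_distrib
        flip: sum_distrib_left sum_divide_distrib)
  finally have avg: "Q \<le> path_density b * u + E + D / 2" .
  have UU: "real (num_level_pairs U (Suc n)) = T * u"
    using card_cross_pairs[OF U U n]
    by (simp add: num_level_pairs_def level_pairs_def cross_pairs_def T_def u_def)
  have "T * (path_density b * u + \<eta>) \<le> T * (path_density b * u + E + D / 2)"
    using dense e mult_left_mono[OF avg less_imp_le[OF T]]
    by (simp add: UU T_def[symmetric] algebra_simps)
  then have \<eta>: "\<eta> \<le> E + D / 2"
    using T by (simp add: mult_le_cancel_left)
  have E: "E\<^sup>2 \<le> real b * D"
  proof -
    have "E * 2 ^ n = (\<Sum>(p, i)\<in>?B \<times> {..<b}. \<bar>?\<delta> i p\<bar>)"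
      by (simp add: E_def sum.cartesian_product)
    then have "(E * 2 ^ n)\<^sup>2 \<le> (\<Sum>(p, i)\<in>?B \<times> {..<b}. (?\<delta> i p)\<^sup>2) * real (card (?B \<times> {..<b}))"
      using sum_squared_le_sum_of_squares[of "\<lambda>(p, i). \<bar>?\<delta> i p\<bar>" "?B \<times> {..<b}"]
      by (simp add: case_prod_unfold)
    also have "\<dots> = D * 2 ^ n * (2 ^ n * real b)"
      by (simp add: D sum.cartesian_product card_cartesian_product card_binary_interval)
    finally show ?thesis by (simp add: power2_eq_square algebra_simps)
  qed
  have D0: "D \<ge> 0" by (simp add: D_def sum_nonneg)
  have "\<eta>\<^sup>2 \<le> (E + D / 2)\<^sup>2"
    using \<eta> \<open>\<eta> > 0\<close> by (intro power_mono) auto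
  also have "\<dots> \<le> 2 * E\<^sup>2 + D\<^sup>2 / 2"
    using sum_squares_ge_zero[of "E - D / 2" 0] by (simp add: power2_eq_square field_simps)
  also have "D\<^sup>2 \<le> D"
    using D0 \<open>D \<le> 1\<close> by (simp add: power2_eq_square mult_left_le)
  finally show ?thesis using E D0 by (simp add: algebra_simps)
qed

theorem proposition6p3:
  fixes b d :: nat and U :: "bool list set" and H :: "bool list set set" and \<eta> :: real
  assumes "b \<ge> 1" and "d \<ge> 1"
    and "U \<subseteq> binary_interval d"
    and "graph_on U H"
    and "\<not> has_monotone_path U H (b + 1)"
    and "\<eta> > 0"
  shows "real (card {l \<in> {1..d}. real (num_level_edges H l) \<ge>
             path_density b * real (num_level_pairs U l) + \<eta> * real (level_size l d)})
         \<le> 36 * (real b + 1) / \<eta>\<^sup>2 + (real b - 1) / (4 * real b * \<eta>)"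
proof -
  obtain c :: "bool list \<Rightarrow> nat" where c: "\<And>x. x \<in> U \<Longrightarrow> c x < b"
    "\<And>x y. x < y \<Longrightarrow> {x, y} \<in> H \<Longrightarrow> c x < c y"
    using colouring_of_no_monotone_path[OF assms(4,5)] by blast
  let ?V = "\<lambda>i. {x \<in> U. c x = i}"
  define D where "D n = (\<Sum>i<b. (\<Sum>p\<in>binary_interval n. (half_jump d (?V i) p)\<^sup>2) / 2 ^ n)" for n
  have D0: "D n \<ge> 0" for n by (simp add: D_def sum_nonneg)
  have "(\<Sum>n<d. D n) \<le> (\<Sum>i<b. card (?V i) / 2 ^ d)"
    unfolding D_def sum.swap[of _ "{..<b}"]
    using assms(3) by (intro sum_mono sum_half_jump_squares_le) auto
  also have "\<dots> = density d U []"
    using density_partition[OF assms(3) c(1), where p = "[]"] by (simp add: density_def cylinder_def)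
  also have "\<dots> \<le> 1" using assms(3) by (simp add: density_le_1)
  finally have D1: "(\<Sum>n<d. D n) \<le> 1" .
  \<comment> \<open>The dense levels, shifted to the depths of their branching nodes.\<close>
  define S where "S = {n. n < d \<and> real (num_level_edges H (Suc n)) \<ge>
      path_density b * real (num_level_pairs U (Suc n)) + \<eta> * real (level_size (Suc n) d)}"
  let ?S = "{l \<in> {1..d}. real (num_level_edges H l) \<ge>
      path_density b * real (num_level_pairs U l) + \<eta> * real (level_size l d)}"
  have "?S = Suc ` S"
  proof (intro equalityI subsetI)
    fix l assume "l \<in> ?S"
    then show "l \<in> Suc ` S" by (cases l) (auto simp: S_def)
  qed (auto simp: S_def)
  then have card: "card ?S = card S" by (simp add: card_image)
  have "\<eta>\<^sup>2 \<le> (2 * real b + 1) * D n" if "n \<in> S" for n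
  proof -
    have n: "n < d" using that by (simp add: S_def)
    then have "D n \<le> (\<Sum>n<d. D n)" using D0 by (intro member_le_sum) auto
    with D1 have "D n \<le> 1" by simp
    then show ?thesis
      using dense_level_energy[OF assms(1,3,4) c n assms(6)] that by (simp add: S_def D_def)
  qed
  then have "(\<Sum>n\<in>S. \<eta>\<^sup>2) \<le> (\<Sum>n\<in>S. (2 * real b + 1) * D n)" by (rule sum_mono)
  also have "\<dots> \<le> (\<Sum>n<d. (2 * real b + 1) * D n)"
    using D0 by (intro sum_mono2) (auto simp: S_def)
  also have "\<dots> \<le> 2 * real b + 1"
    using D1 by (simp add: mult_left_le flip: sum_distrib_left)
  also have "\<dots> \<le> 36 * (real b + 1)" by simp
  finally have "real (card S) \<le> 36 * (real b + 1) / \<eta>\<^sup>2"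
    using assms(6) by (simp add: pos_le_divide_eq)
  moreover have "0 \<le> (real b - 1) / (4 * real b * \<eta>)"
    using assms(1,6) by simp
  ultimately show ?thesis unfolding card by linarith
qed

end
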